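(* Let $F=\{f_i\}_{i=1}^N$ be a Parseval $K$-frame for $\mathcal{H}_n$, where $K$ is a positive semi-definite operator on $\mathcal{H}_n$. Let $M:=\max\{\|(K^\dagger)^{1/2}f_i\|^2:1\le i\le N\}$, $J_1:=\{i:\|(K^\dagger)^{1/2}f_i\|^2=M\}$, $J_2:=\{1,\dots,N\}\setminus J_1$, and $W_j:=\operatorname{span}\{f_i:i\in J_j\}$ for $j=1,2$. If $W_1\cap W_2=\{0\}$, then the canonical $K$-dual $\{K^\dagger f_i\}_{i=1}^N$ is a $1$-erasure spectrally optimal $K$-dual of $F$.
   Context: $\mathcal{H}_n$ is an $n$-dimensional Hilbert space (over $\mathbb{R}$ or $\mathbb{C}$). For a bounded operator $K$ on $\mathcal{H}_n$, a sequence $F=\{f_i\}_{i=1}^N\subset\mathcal{H}_n$ is a Parseval $K$-frame if $\sum_{i=1}^N|\langle f,f_i\rangle|^2=\|K^*f\|^2$ for all $f$. A sequence $G=\{g_i\}_{i=1}^N\subset\mathcal{H}_n$ is a $K$-dual of $F$ if $Kf=\sum_{i=1}^N\langle f,g_i\rangle f_i$ for all $f\in\mathcal{H}_n$. $K^\dagger$ is the Moore–Penrose pseudoinverse of $K$; for a Parseval $K$-frame $F$, $\{K^\dagger f_i\}_{i=1}^N$ is a $K$-dual, called the canonical $K$-dual. For a $K$-dual $G$ of $F$, $r_1(F,G):=\max_{1\le i\le N}|\langle f_i,g_i\rangle|$ (the maximum spectral radius of the error operators $f\mapsto\langle f,f_i\rangle g_i$). Set $\tilde r_1(F):=\inf\{r_1(F,G):G\text{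 is a }K\text{-dual of }F\}$; a $K$-dual $\tilde G$ of $F$ is $1$-erasure spectrally optimal if $r_1(F,\tilde G)=\tilde r_1(F)$. *)

theory Defs
  imports Complex_Main "Jordan_Normal_Form.Conjugate"
begin

text \<open>Scalars: a common abstraction of \<open>\<real>\<close> and \<open>\<complex>\<close>. The axiom is
  \<open>x * conjugate x = \<bar>x\<bar>\<^sup>2\<close>; for \<open>x \<noteq> 0\<close> it determines \<open>conjugate x\<close> as
  \<open>\<bar>x\<bar>\<^sup>2 / x\<close>, so the class adds no freedom beyond the choice of the field.\<close>

class real_or_complex_field = real_normed_field + conjugatable_field +
  assumes mult_conjugate: "x * conjugate x = ((norm x)\<^sup>2) *\<^sub>R 1"

instance real :: real_or_complex_field
  by standard (simp add: power2_eq_square)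

instance complex :: real_or_complex_field
  by standard (simp add: complex_norm_square[symmetric] scaleR_conv_of_real del: of_real_power)

text \<open>An \<open>n\<close>-dimensional Hilbert space; the inner product is linear in the first argument.
  Completeness need not be required, and every linear operator is bounded, since the
  dimension is finite.\<close>

locale hilbert_space = vector_space scale
  for scale :: "'k::real_or_complex_field \<Rightarrow> 'v::ab_group_add \<Rightarrow> 'v" (infixr \<open>*s\<close> 75) +
  fixes ip :: "'v \<Rightarrow> 'v \<Rightarrow> 'k"
    and n :: nat
  assumes ip_add_left: "ip (x + y) z = ip x z + ip y z"
    and ip_scale_left: "ip (c *s x) y = c * ip x y"
    and ip_commute: "ip x y = conjugate (ip y x)"
    and ip_self_pos: "x \<noteq> 0 \<Longrightarrow> \<exists>r>0. ip x x = of_real r"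
    and finite_dimension: "\<exists>B. finite B \<and> card B = n \<and> independent B \<and> span B = UNIV"
begin

definition hnorm :: "'v \<Rightarrow> real" where
  "hnorm x = sqrt (norm (ip x x))"

definition operator :: "('v \<Rightarrow> 'v) \<Rightarrow> bool" where
  "operator T \<longleftrightarrow> Vector_Spaces.linear scale scale T"

definition adj :: "('v \<Rightarrow> 'v) \<Rightarrow> 'v \<Rightarrow> 'v" where
  "adj T = (THE S. \<forall>x y. ip (T x) y = ip x (S y))"

text \<open>Self-adjointness is implied by the last conjunct over \<open>\<complex>\<close>, but not over \<open>\<real>\<close>.\<close>

definition pos_semidef :: "('v \<Rightarrow> 'v) \<Rightarrow> bool" where
  "pos_semidef T \<longleftrightarrow> operator T \<and> adj T = T \<and> (\<forall>x. \<exists>r\<ge>0. ip (T x) x = of_real r)"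

definition pos_sqrt :: "('v \<Rightarrow> 'v) \<Rightarrow> 'v \<Rightarrow> 'v" where
  "pos_sqrt T = (THE S. pos_semidef S \<and> S \<circ> S = T)"

text \<open>The Moore--Penrose pseudoinverse, by the four Penrose equations.\<close>

definition pinv :: "('v \<Rightarrow> 'v) \<Rightarrow> 'v \<Rightarrow> 'v" where
  "pinv T = (THE X. operator X \<and> T \<circ> X \<circ> T = T \<and> X \<circ> T \<circ> X = X \<and>
      adj (T \<circ> X) = T \<circ> X \<and> adj (X \<circ> T) = X \<circ> T)"

text \<open>A sequence \<open>{f\<^sub>i}\<close>, \<open>1 \<le> i \<le> N\<close>, is a function on \<open>nat\<close> of which only
  the values on \<open>{1..N}\<close> are used.\<close>

definition parseval_frame :: "('v \<Rightarrow> 'v) \<Rightarrow> nat \<Rightarrow> (nat \<Rightarrow> 'v) \<Rightarrow> bool" where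
  "parseval_frame K N f \<longleftrightarrow> (\<forall>x. (\<Sum>i=1..N. (norm (ip x (f i)))\<^sup>2) = (hnorm (adj K x))\<^sup>2)"

definition K_dual :: "('v \<Rightarrow> 'v) \<Rightarrow> nat \<Rightarrow> (nat \<Rightarrow> 'v) \<Rightarrow> (nat \<Rightarrow> 'v) \<Rightarrow> bool" where
  "K_dual K N f g \<longleftrightarrow> (\<forall>x. K x = (\<Sum>i=1..N. ip x (g i) *s f i))"

definition r1 :: "nat \<Rightarrow> (nat \<Rightarrow> 'v) \<Rightarrow> (nat \<Rightarrow> 'v) \<Rightarrow> real" where
  "r1 N f g = Max ((\<lambda>i. norm (ip (f i) (g i))) ` {1..N})"

definition r1_inf :: "('v \<Rightarrow> 'v) \<Rightarrow> nat \<Rightarrow> (nat \<Rightarrow> 'v) \<Rightarrow> real" where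
  "r1_inf K N f = Inf {r1 N f g | g. K_dual K N f g}"

definition spectrally_optimal ::
    "('v \<Rightarrow> 'v) \<Rightarrow> nat \<Rightarrow> (nat \<Rightarrow> 'v) \<Rightarrow> (nat \<Rightarrow> 'v) \<Rightarrow> bool" where
  "spectrally_optimal K N f g \<longleftrightarrow> K_dual K N f g \<and> r1 N f g = r1_inf K N f"

definition canonical_dual :: "('v \<Rightarrow> 'v) \<Rightarrow> (nat \<Rightarrow> 'v) \<Rightarrow> nat \<Rightarrow> 'v" where
  "canonical_dual K f = (\<lambda>i. pinv K (f i))"

end

end

theory Submission
  imports Defs "HOL-Computational_Algebra.Fundamental_Theorem_Algebra"
begin

text \<open>
  The proof compares traces. Let \<open>G\<close> be any \<open>K\<close>-dual and put \<open>h\<^sub>i = g\<^sub>i - K\<^sup>\<dagger> f\<^sub>i\<close>. Both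
  sequences are duals, so \<open>\<Sum>\<^sub>i \<langle>x, h\<^sub>i\<rangle> f\<^sub>i = 0\<close> for all \<open>x\<close>. As \<open>W\<^sub>1\<close> and \<open>W\<^sub>2\<close> meet only
  in \<open>0\<close>, the part of the sum over \<open>J\<^sub>1\<close> is already zero, and taking the trace of this zero
  operator gives \<open>\<Sum>\<^bsub>i \<in> J\<^sub>1\<^esub> \<langle>f\<^sub>i, h\<^sub>i\<rangle> = 0\<close> (lemma \<open>trace_zero\<close>). Hence the
  numbers \<open>\<langle>f\<^sub>i, g\<^sub>i\<rangle>\<close> with \<open>i \<in> J\<^sub>1\<close> have the same sum as the numbers
  \<open>\<langle>f\<^sub>i, K\<^sup>\<dagger> f\<^sub>i\<rangle> = \<parallel>(K\<^sup>\<dagger>)\<^sup>1\<^sup>/\<^sup>2 f\<^sub>i\<parallel>\<^sup>2 = M\<close>, so one of them has modulus at least \<open>M\<close>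
  (lemma \<open>r1_ge_if_constant_on_block\<close>), and the canonical dual attains \<open>M\<close>.

  The adjoint, the pseudoinverse and the square root are given by unique descriptions, so their
  existence and uniqueness have to be proved, over a field that is only known through its norm and
  a conjugation with \<open>x * conjugate x = \<bar>x\<bar>\<^sup>2\<close>. Adjoints come from the Riesz representation theorem. The
  other two are real polynomials in the operator: a self-adjoint \<open>T\<close> is annihilated by a
  nonzero real polynomial (lemma \<open>real_annihilator\<close>), and if \<open>T\<close> is positive, a polynomial in
  \<open>T\<close> depends only on its values on a finite set of nonnegative numbers (lemma
  \<open>spectrum\<close>). Interpolating \<open>1 / \<lambda>\<close> and \<open>\<surd>\<lambda>\<close> on this set then gives
  \<open>T\<^sup>\<dagger>\<close> and \<open>T\<^sup>1\<^sup>/\<^sup>2\<close>. No eigenvectors are needed, and the complex roots of real polynomials enter only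
  through quadratic factors, so the real and the complex case are treated alike.
\<close>

section \<open>Scalars\<close>

lemma conjugate_of_real [simp]:
  "conjugate (of_real r :: 'k::real_or_complex_field) = of_real r"
proof (cases "r = 0")
  case False
  have "of_real r * conjugate (of_real r :: 'k) = of_real r * of_real r"
    by (simp add: mult_conjugate scaleR_conv_of_real power2_eq_square)
  then show ?thesis
    using False by simp
qed simp

lemma conjugate_one [simp]: "conjugate (1 :: 'k::real_or_complex_field) = 1"
  using conjugate_of_real[of 1] by simp

lemma conjugate_mult_self:
  "conjugate x * x = (of_real ((norm x)\<^sup>2) :: 'k::real_or_complex_field)"
  using mult_conjugate[of x] by (simp add: mult.commute scaleR_conv_of_real)

text \<open>The numbers \<open>x\<close> and \<open>conjugate x\<close> have a real product. Applying this to \<open>x + 1\<close>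
  as well shows that their sum is also real.\<close>

lemma add_conjugate_real:
  obtains r where "x + conjugate x = (of_real r :: 'k::real_or_complex_field)"
proof -
  have "x + conjugate x = (x + 1) * conjugate (x + 1) - x * conjugate x - 1"
    by (simp add: conjugate_dist_add algebra_simps)
  also have "\<dots> = of_real ((norm (x + 1))\<^sup>2 - (norm x)\<^sup>2 - 1)"
    unfolding mult_conjugate by (simp add: scaleR_conv_of_real)
  finally show thesis using that by blast
qed

section \<open>Roots and interpolation of real polynomials\<close>

lemma poly_of_real_add:
  "poly (map_poly complex_of_real (p + q)) z =
    poly (map_poly of_real p) z + poly (map_poly of_real q) z"
  by (induction p q rule: poly_induct2) (simp_all add: map_poly_pCons algebra_simps)

lemma poly_of_real_mult:
  "poly (map_poly complex_of_real (p * q)) z =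
    poly (map_poly of_real p) z * poly (map_poly of_real q) z"
proof (induction p)
  case (pCons a p)
  have "poly (map_poly complex_of_real (smult a q)) z = of_real a * poly (map_poly of_real q) z"
    by (induction q) (simp_all add: map_poly_pCons algebra_simps)
  with pCons show ?case
    by (simp add: poly_of_real_add map_poly_pCons algebra_simps)
qed simp

lemma poly_of_real:
  "poly (map_poly complex_of_real p) (of_real x) = of_real (poly p x)"
  by (induction p) (simp_all add: map_poly_pCons)

text \<open>The remainder modulo the quadratic has degree at most one and real coefficients, and it
  vanishes at the point \<open>a + b \<i>\<close> off the real line, so it is zero.\<close>

lemma quadratic_dvd_if_complex_root:
  fixes p :: "real poly"
  assumes root: "poly (map_poly of_real p) (Complex a b) = 0" and b: "b \<noteq> 0"
  shows "[:a\<^sup>2 + b\<^sup>2, - 2 * a, 1:] dvd p"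
proof -
  let ?Q = "[:a\<^sup>2 + b\<^sup>2, - 2 * a, 1:]"
  define r where "r = p mod ?Q"
  have hom: "poly (map_poly complex_of_real (u * v + w)) z =
      poly (map_poly of_real u) z * poly (map_poly of_real v) z + poly (map_poly of_real w) z"
    for u v w z
    by (simp add: poly_of_real_add poly_of_real_mult)
  have "degree r < 2"
    using degree_mod_less[of ?Q p] by (auto simp: r_def)
  then have r: "r = [:coeff r 0, coeff r 1:]"
    by (intro poly_eqI) (auto simp: coeff_pCons coeff_eq_0 split: nat.split)
  have "poly (map_poly of_real ?Q) (Complex a b) = 0"
    by (simp add: map_poly_pCons complex_eq_iff power2_eq_square algebra_simps)
  then have "poly (map_poly of_real r) (Complex a b) = 0"
    using root hom[of "p div ?Q" ?Q r "Complex a b"] by (simp only: r_def div_mult_mod_eq) simp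
  then have "coeff r 1 * b = 0" "coeff r 0 + coeff r 1 * a = 0"
    by (subst (asm) r, simp add: map_poly_pCons complex_eq_iff algebra_simps)+
  then have "r = 0"
    using b r by simp
  then show ?thesis
    by (simp add: r_def mod_eq_0_iff_dvd)
qed

lemma real_poly_factor:
  fixes p :: "real poly"
  assumes "degree p > 0"
  obtains (linear) a where "[:- a, 1:] dvd p"
  | (quadratic) a b where "b \<noteq> 0" "[:a\<^sup>2 + b\<^sup>2, - 2 * a, 1:] dvd p"
proof -
  have "degree (map_poly complex_of_real p) > 0"
    using assms by (simp add: degree_map_poly)
  then have "\<not> constant (poly (map_poly complex_of_real p))"
    by (simp add: constant_degree)
  then obtain z where z: "poly (map_poly complex_of_real p) z = 0"
    using fundamental_theorem_of_algebra by blast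
  show thesis
  proof (cases "Im z = 0")
    case True
    then have "z = of_real (Re z)"
      by (simp add: complex_eq_iff)
    then have "complex_of_real (poly p (Re z)) = 0"
      using z by (metis poly_of_real)
    then show ?thesis
      using linear by (simp add: poly_eq_0_iff_dvd)
  next
    case False
    then show ?thesis
      using quadratic quadratic_dvd_if_complex_root[of p "Re z" "Im z"] z by simp
  qed
qed

lemma real_poly_interpolation:
  fixes h :: "real \<Rightarrow> real"
  assumes "finite L"
  obtains q where "\<forall>l\<in>L. poly q l = h l"
proof -
  have "\<exists>q. \<forall>l\<in>L. poly q l = h l"
    using assms
  proof (induction L)
    case (insert a L)
    then obtain q where q: "\<forall>l\<in>L. poly q l = h l" by blast
    define w where "w = (\<Prod>l\<in>L. [:- l, 1:])"
    have w: "poly w x = (\<Prod>l\<in>L. x - l)" for x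
      by (simp add: w_def poly_prod)
    have "poly w a \<noteq> 0"
      using insert by (auto simp: w)
    moreover have "\<forall>l\<in>L. poly w l = 0"
      using insert by (auto simp: w)
    ultimately have "\<forall>l\<in>insert a L. poly (q + smult ((h a - poly q a) / poly w a) w) l = h l"
      using q by auto
    then show ?case by blast
  qed simp
  then show thesis using that by blast
qed

section \<open>Inner products and adjoints\<close>

context hilbert_space
begin

lemma ip_add_right: "ip x (y + z) = ip x y + ip x z"
  by (metis ip_add_left ip_commute conjugate_dist_add)

lemma ip_scale_right: "ip x (c *s y) = conjugate c * ip x y"
  by (metis ip_scale_left ip_commute conjugate_dist_mul)

lemma ip_zero_left [simp]: "ip 0 x = 0"
  using ip_add_left[of 0 0 x] by simp

lemma ip_zero_right [simp]: "ip x 0 = 0"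
  using ip_add_right[of x 0 0] by simp

lemma ip_diff_left: "ip (x - y) z = ip x z - ip y z"
  using ip_add_left[of "x - y" y z] by simp

lemma ip_diff_right: "ip x (y - z) = ip x y - ip x z"
  using ip_add_right[of x "y - z" z] by simp

lemma ip_sum_left: "ip (\<Sum>i\<in>I. g i) x = (\<Sum>i\<in>I. ip (g i) x)"
  by (induction I rule: infinite_finite_induct) (auto simp: ip_add_left)

lemma ip_sum_right: "ip x (\<Sum>i\<in>I. g i) = (\<Sum>i\<in>I. ip x (g i))"
  by (induction I rule: infinite_finite_induct) (auto simp: ip_add_right)

lemma ip_self: "ip x x = of_real ((hnorm x)\<^sup>2)"
proof (cases "x = 0")
  case False
  then obtain r where "r > 0" "ip x x = of_real r"
    using ip_self_pos by blast
  then show ?thesis by (simp add: hnorm_def)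
qed (simp add: hnorm_def)

lemma hnorm_eq_0_iff: "hnorm x = 0 \<longleftrightarrow> x = 0"
  using ip_self_pos[of x] by (cases "x = 0") (auto simp: hnorm_def)

lemma ip_self_eq_0_iff: "ip x x = 0 \<longleftrightarrow> x = 0"
  by (simp add: ip_self hnorm_eq_0_iff)

lemma ip_left_unique:
  assumes "\<And>z. ip x z = ip y z"
  shows "x = y"
proof -
  have "ip (x - y) (x - y) = 0"
    using assms by (simp add: ip_diff_left)
  then show ?thesis by (simp add: ip_self_eq_0_iff)
qed

lemma ip_right_unique:
  assumes "\<And>z. ip z x = ip z y"
  shows "x = y"
  using assms by (metis ip_commute ip_left_unique)

lemma operatorI:
  assumes "\<And>x y. T (x + y) = T x + T y" "\<And>c x. T (c *s x) = c *s T x"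
  shows "operator T"
  unfolding operator_def
  using assms by (simp add: Vector_Spaces.linear_iff vector_space_axioms)

lemma
  assumes "operator T"
  shows operator_add: "T (x + y) = T x + T y"
    and operator_scale: "T (c *s x) = c *s T x"
  using assms unfolding operator_def by (simp_all add: Vector_Spaces.linear_iff)

lemma operator_zero: "operator T \<Longrightarrow> T 0 = 0"
  using operator_scale[of T 0 0] by simp

lemma operator_diff: "operator T \<Longrightarrow> T (x - y) = T x - T y"
  using operator_add[of T "x - y" y] by simp

lemma operator_sum: "operator T \<Longrightarrow> T (\<Sum>i\<in>I. g i) = (\<Sum>i\<in>I. T (g i))"
  by (induction I rule: infinite_finite_induct) (auto simp: operator_add operator_zero)

lemma operator_zero_on_span:
  assumes "operator T" "\<forall>b\<in>B. T b = 0" "x \<in> span B"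
  shows "T x = 0"
proof -
  have "subspace {x. T x = 0}"
    using assms(1) by (intro subspaceI) (auto simp: operator_add operator_scale operator_zero)
  then show ?thesis
    using span_minimal[of B "{x. T x = 0}"] assms by blast
qed

text \<open>The representing vector is built by Gram--Schmidt. When \<open>b\<close> is added to \<open>B\<close>, the
  induction hypothesis for \<open>x \<mapsto> \<langle>x, b\<rangle>\<close> yields a vector \<open>p\<close> that agrees with \<open>b\<close> under inner
  products with \<open>B\<close>, so \<open>b - p\<close> is orthogonal to \<open>B\<close> and can be used to correct
  the value at \<open>b\<close> alone. Having \<open>p\<close> in the span handles the case \<open>b = p\<close>, where the value
  at \<open>b\<close> is forced.\<close>

lemma riesz_on_finite:
  assumes "finite B"
    and "\<And>x y. \<phi> (x + y) = \<phi> x + \<phi> y" "\<And>c x. \<phi> (c *s x) = c * \<phi> x"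
  shows "\<exists>y\<in>span B. \<forall>x\<in>span B. \<phi> x = ip x y"
  using assms
proof (induction B arbitrary: \<phi>)
  case empty
  from empty(2)[of 0 0] show ?case
    by (intro bexI[of _ 0]) (auto simp: span_zero)
next
  case (insert b B)
  have ext: "\<forall>x\<in>span C. \<phi> x = ip x y" if "\<forall>x\<in>C. \<phi> x = ip x y" for C y
  proof -
    have "\<phi> 0 = 0"
      using insert.prems(1)[of 0 0] by simp
    then have "subspace {x. \<phi> x = ip x y}"
      by (intro subspaceI) (auto simp: insert.prems ip_add_left ip_scale_left)
    then show ?thesis
      using span_minimal[of C "{x. \<phi> x = ip x y}"] that by blast
  qed
  obtain y where y: "y \<in> span B" "\<forall>x\<in>span B. \<phi> x = ip x y"
    using insert.IH[OF insert.prems] by blast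
  obtain p where p: "p \<in> span B" "\<forall>x\<in>span B. ip x b = ip x p"
    using insert.IH[of "\<lambda>x. ip x b"] by (auto simp: ip_add_left ip_scale_left)
  have span_B: "span B \<subseteq> span (insert b B)"
    by (intro span_mono) auto
  show ?case
  proof (cases "b = p")
    case True
    then have "b \<in> span B"
      using p(1) by simp
    then have "\<forall>x\<in>insert b B. \<phi> x = ip x y"
      using y(2) by (auto intro: span_base)
    then have "\<forall>x\<in>span (insert b B). \<phi> x = ip x y"
      by (rule ext)
    then show ?thesis
      using y(1) span_B by blast
  next
    case False
    define e where "e = b - p"
    have orth: "ip x e = 0" if "x \<in> span B" for x
      using p that by (simp add: e_def ip_diff_right)
    have "ip b e = ip e e"
      using orth[OF p(1)] by (simp add: e_def ip_diff_left)
    then have nz: "ip b e \<noteq> 0"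
      using False by (simp add: ip_self_eq_0_iff e_def)
    define c where "c = conjugate ((\<phi> b - ip b y) / ip b e)"
    have "\<phi> b = ip b (y + c *s e)"
      using nz by (simp add: ip_add_right ip_scale_right c_def)
    moreover have "\<phi> x = ip x (y + c *s e)" if "x \<in> B" for x
      using y that orth by (simp add: ip_add_right ip_scale_right span_base)
    ultimately have "\<forall>x\<in>span (insert b B). \<phi> x = ip x (y + c *s e)"
      by (intro ext) auto
    moreover have "y + c *s e \<in> span (insert b B)"
      using y p span_B unfolding e_def
      by (intro span_add span_scale span_diff) (auto intro: span_base)
    ultimately show ?thesis by blast
  qed
qed

lemma adj_eq_iff:
  assumes "operator T"
  shows "adj T = S \<longleftrightarrow> (\<forall>x y. ip (T x) y = ip x (S y))"
proof -
  obtain B where B: "finite B" "span B = UNIV"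
    using finite_dimension by blast
  have "\<exists>z. \<forall>x. ip (T x) y = ip x z" for y
    using riesz_on_finite[OF B(1), of "\<lambda>x. ip (T x) y"] assms
    by (auto simp: B operator_add operator_scale ip_add_left ip_scale_left)
  then obtain S0 where S0: "\<forall>x y. ip (T x) y = ip x (S0 y)"
    by metis
  have unique: "S = S0" if "\<forall>x y. ip (T x) y = ip x (S y)" for S
    by (rule ext, rule ip_right_unique) (metis that S0)
  then have "adj T = S0"
    unfolding adj_def using S0 by (intro the_equality) blast+
  then show ?thesis
    using S0 unique by blast
qed

definition selfadjoint :: "('v \<Rightarrow> 'v) \<Rightarrow> bool" where
  "selfadjoint T \<longleftrightarrow> (\<forall>x y. ip (T x) y = ip x (T y))"

lemma selfadjointD: "selfadjoint T \<Longrightarrow> ip (T x) y = ip x (T y)"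
  by (simp add: selfadjoint_def)

lemma adj_eq_self_iff: "operator T \<Longrightarrow> adj T = T \<longleftrightarrow> selfadjoint T"
  by (simp add: adj_eq_iff selfadjoint_def)

lemma pos_semidef_iff:
  "pos_semidef T \<longleftrightarrow> operator T \<and> selfadjoint T \<and> (\<forall>x. \<exists>r\<ge>0. ip (T x) x = of_real r)"
  unfolding pos_semidef_def using adj_eq_self_iff by blast

text \<open>Expanding the form at \<open>x + T x\<close> leaves twice \<open>\<langle>T x, T x\<rangle>\<close>.\<close>

lemma selfadjoint_eq_0_if_form_0:
  assumes "operator T" "selfadjoint T" and form: "\<And>x. ip (T x) x = 0"
  shows "T x = 0"
proof -
  have "0 = ip (T (x + T x)) (x + T x)"
    by (simp add: form)
  also have "\<dots> = ip (T x) (T x) + ip (T (T x)) x"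
    by (simp add: operator_add[OF assms(1)] ip_add_left ip_add_right form)
  also have "ip (T (T x)) x = ip (T x) (T x)"
    using assms(2) by (rule selfadjointD)
  finally have "2 * ip (T x) (T x) = 0"
    by simp
  then show ?thesis
    by (simp add: ip_self_eq_0_iff)
qed

lemma selfadjoint_kernel_square:
  assumes "selfadjoint T" "operator T" "T (T x) = 0"
  shows "T x = 0"
  using selfadjointD[OF assms(1), of x "T x"] selfadjointD[OF assms(1), of "T x" x] assms(3)
  by (simp add: ip_self_eq_0_iff)

section \<open>Real polynomials in an operator\<close>

definition op_poly :: "('v \<Rightarrow> 'v) \<Rightarrow> real poly \<Rightarrow> 'v \<Rightarrow> 'v" where
  "op_poly T p = fold_coeffs (\<lambda>a S x. of_real a *s x + T (S x)) p (\<lambda>_. 0)"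

lemma op_poly_0 [simp]: "op_poly T 0 x = 0"
  by (simp add: op_poly_def)

lemma op_poly_pCons:
  assumes "operator T"
  shows "op_poly T (pCons a p) x = of_real a *s x + T (op_poly T p x)"
  by (cases "a = 0 \<and> p = 0") (auto simp: op_poly_def operator_zero[OF assms])

lemma op_poly_operator:
  assumes "operator T"
  shows "operator (op_poly T p)"
proof (induction p)
  case (pCons a p)
  then show ?case
    by (intro operatorI)
      (simp_all add: op_poly_pCons operator_add operator_scale assms scale_right_distrib
        mult.commute)
qed (auto intro: operatorI)

lemma op_poly_add:
  assumes "operator T"
  shows "op_poly T (p + q) x = op_poly T p x + op_poly T q x"
proof (induction p q rule: poly_induct2)
  case (pCons a p b q)
  then show ?case
    by (simp add: op_poly_pCons operator_add assms scale_left_distrib)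
qed simp

lemma op_poly_smult:
  assumes "operator T"
  shows "op_poly T (smult c p) x = of_real c *s op_poly T p x"
  by (induction p)
    (simp_all add: op_poly_pCons operator_scale assms scale_right_distrib)

lemma op_poly_diff:
  assumes "operator T"
  shows "op_poly T (p - q) x = op_poly T p x - op_poly T q x"
  using op_poly_add[OF assms, of "p - q" q x] by simp

lemma op_poly_mult:
  assumes "operator T"
  shows "op_poly T (p * q) x = op_poly T p (op_poly T q x)"
  by (induction p) (simp_all add: op_poly_pCons op_poly_add op_poly_smult assms)

lemma op_poly_X: "operator T \<Longrightarrow> op_poly T [:0, 1:] x = T x"
  by (simp add: op_poly_pCons operator_zero)

lemma op_poly_monom:
  assumes "operator T"
  shows "op_poly T (monom c i) x = of_real c *s (T ^^ i) x"
  by (induction i) (simp_all add: monom_0 monom_Suc op_poly_pCons operator_scale operator_zero assms)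

lemma op_poly_sum:
  assumes "operator T"
  shows "op_poly T (\<Sum>i\<in>I. p i) x = (\<Sum>i\<in>I. op_poly T (p i) x)"
  by (induction I rule: infinite_finite_induct) (simp_all add: op_poly_add assms)

lemma op_poly_commute:
  assumes "operator T" "operator S" "\<And>x. S (T x) = T (S x)"
  shows "S (op_poly T p x) = op_poly T p (S x)"
  by (induction p)
    (simp_all add: op_poly_pCons operator_zero operator_add operator_scale assms)

lemma op_poly_selfadjoint:
  assumes "operator T" "selfadjoint T"
  shows "selfadjoint (op_poly T p)"
proof (induction p)
  case (pCons a p)
  have "ip (T (op_poly T p x)) y = ip x (T (op_poly T p y))" for x y
    using selfadjointD[OF assms(2)] selfadjointD[OF pCons(2)]
      op_poly_commute[OF assms(1) assms(1)] by simp
  then show ?case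
    by (simp add: selfadjoint_def op_poly_pCons assms ip_add_left ip_add_right
        ip_scale_left ip_scale_right)
qed (simp add: selfadjoint_def)

section \<open>The functional calculus of a positive operator\<close>

text \<open>A linear relation \<open>\<Sum>\<^sub>i c\<^sub>i T\<^sup>i x = 0\<close> exists by finite dimension. It can be made real
  because the moments \<open>\<langle>T\<^sup>i x, T\<^sup>j x\<rangle>\<close> are fixed by conjugation: conjugating the equations
  \<open>\<Sum>\<^sub>i c\<^sub>i \<langle>T\<^sup>i x, T\<^sup>j x\<rangle> = 0\<close> shows that the relation with conjugated coefficients also
  holds. Hence so does the sum of both relations.\<close>

lemma real_annihilator_of_vector:
  assumes T: "operator T" "selfadjoint T"
  obtains p where "p \<noteq> 0" "op_poly T p x = 0"
proof (cases "inj (\<lambda>i. (T ^^ i) x)")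
  case False
  then obtain i j where ij: "i \<noteq> j" "(T ^^ i) x = (T ^^ j) x"
    by (auto simp: inj_def)
  have "coeff (monom (1::real) i - monom 1 j) i \<noteq> 0"
    using ij by simp
  then have "monom (1::real) i - monom 1 j \<noteq> 0"
    by (metis coeff_0)
  moreover have "op_poly T (monom 1 i - monom 1 j) x = 0"
    by (simp add: op_poly_diff op_poly_monom T ij)
  ultimately show ?thesis by (rule that)
next
  case True
  obtain B where B: "finite B" "span B = UNIV"
    using finite_dimension by blast
  have "dependent (range (\<lambda>i. (T ^^ i) x))"
    using independent_span_bound[OF B(1)] B(2) range_inj_infinite[OF True] by auto
  then obtain X u where X: "finite X" "X \<subseteq> range (\<lambda>i. (T ^^ i) x)"
      "(\<Sum>v\<in>X. u v *s v) = 0" "\<exists>v\<in>X. u v \<noteq> 0"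
    unfolding dependent_explicit by blast
  obtain I where I: "X = (\<lambda>i. (T ^^ i) x) ` I" "finite I"
    using finite_subset_image[OF X(1,2)] by blast
  define d where "d i = u ((T ^^ i) x)" for i
  have "inj_on (\<lambda>i. (T ^^ i) x) I"
    using True by (rule inj_on_subset) simp
  then have d: "(\<Sum>i\<in>I. d i *s (T ^^ i) x) = 0"
    using X(3) unfolding I d_def by (simp add: sum.reindex)
  obtain j where j: "j \<in> I" "d j \<noteq> 0"
    using X(4) unfolding I d_def by blast
  \<comment> \<open>The factor makes the coefficient at \<open>j\<close> real, so that its real part does not vanish.\<close>
  define c where "c i = conjugate (d j) * d i" for i
  have "(\<Sum>i\<in>I. c i *s (T ^^ i) x) = conjugate (d j) *s (\<Sum>i\<in>I. d i *s (T ^^ i) x)"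
    by (simp add: c_def scale_sum_right)
  then have c: "(\<Sum>i\<in>I. c i *s (T ^^ i) x) = 0"
    by (simp add: d)
  have "\<forall>i. \<exists>r. c i + conjugate (c i) = of_real r"
    using add_conjugate_real by metis
  then obtain r where r: "\<And>i. of_real (r i) = c i + conjugate (c i)"
    by metis
  define p where "p = (\<Sum>i\<in>I. monom (r i) i)"
  have "coeff p j = r j"
    using j I(2) by (simp add: p_def coeff_sum)
  moreover have "c j = of_real ((norm (d j))\<^sup>2)"
    unfolding c_def by (rule conjugate_mult_self)
  then have "(of_real (r j) :: 'k) = of_real (2 * (norm (d j))\<^sup>2)"
    using r[of j] by (simp del: of_real_power)
  then have "r j = 2 * (norm (d j))\<^sup>2"
    by (simp only: of_real_eq_iff)
  ultimately have p: "p \<noteq> 0"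
    using j by auto
  define w where "w = op_poly T p x"
  have w: "w = (\<Sum>i\<in>I. of_real (r i) *s (T ^^ i) x)"
    by (simp add: w_def p_def op_poly_sum op_poly_monom T)
  have power: "ip ((T ^^ i) y) z = ip y ((T ^^ i) z)" for i y z
    by (induction i arbitrary: y z) (simp_all add: selfadjointD[OF T(2)] funpow_swap1)
  have moment: "conjugate (ip ((T ^^ i) x) ((T ^^ k) x)) = ip ((T ^^ i) x) ((T ^^ k) x)" for i k
  proof -
    have "ip ((T ^^ k) x) ((T ^^ i) x) = ip ((T ^^ i) x) ((T ^^ k) x)"
      unfolding power by (metis add.commute comp_apply funpow_add)
    then show ?thesis by (metis ip_commute)
  qed
  have "ip w ((T ^^ k) x) = 0" for k
  proof -
    have 0: "(\<Sum>i\<in>I. c i * ip ((T ^^ i) x) ((T ^^ k) x)) = 0"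
      using arg_cong[OF c, of "\<lambda>v. ip v ((T ^^ k) x)"] by (simp add: ip_sum_left ip_scale_left)
    then have "conjugate (\<Sum>i\<in>I. c i * ip ((T ^^ i) x) ((T ^^ k) x)) = 0"
      by simp
    then have "(\<Sum>i\<in>I. conjugate (c i) * ip ((T ^^ i) x) ((T ^^ k) x)) = 0"
      by (simp add: sum_conjugate I conjugate_dist_mul moment)
    with 0 show ?thesis
      by (simp add: w ip_sum_left ip_scale_left r distrib_right sum.distrib)
  qed
  then have "ip w w = 0"
    by (subst (2) w) (simp add: ip_sum_right ip_scale_right)
  then show ?thesis
    using that p by (simp add: ip_self_eq_0_iff w_def)
qed

lemma real_annihilator:
  assumes T: "operator T" "selfadjoint T"
  obtains p where "p \<noteq> 0" "\<And>x. op_poly T p x = 0"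
proof -
  obtain B where B: "finite B" "span B = UNIV"
    using finite_dimension by blast
  have "\<exists>p. p \<noteq> 0 \<and> (\<forall>b\<in>B. op_poly T p b = 0)"
    using B(1)
  proof (induction B)
    case (insert b B)
    then obtain p where p: "p \<noteq> 0" "\<forall>b\<in>B. op_poly T p b = 0" by blast
    obtain q where q: "q \<noteq> 0" "op_poly T q b = 0"
      using real_annihilator_of_vector[OF T] by blast
    have "op_poly T (q * p) v = 0" if "v \<in> insert b B" for v
      using that p q op_poly_mult[OF T(1), of q p v] op_poly_mult[OF T(1), of p q v]
        operator_zero[OF op_poly_operator[OF T(1)]]
      by (auto simp: mult.commute)
    then show ?case
      using p q by (intro exI[of _ "q * p"]) auto
  qed (auto intro: exI[of _ 1])
  then show thesis
    using that operator_zero_on_span[OF op_poly_operator[OF T(1)]] B(2) by blast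
qed

text \<open>The factors of an annihilating polynomial \<open>p\<close> are removed one at a time. Factors with no
  root in \<open>[0, \<infinity>)\<close> are injective at a positive operator: for the quadratic
  \<open>(t - a)\<^sup>2 + b\<^sup>2\<close> the quadratic form is \<open>\<parallel>(T - a) y\<parallel>\<^sup>2 + b\<^sup>2 \<parallel>y\<parallel>\<^sup>2\<close>. A factor
  \<open>t - a\<close> with \<open>a \<ge> 0\<close> is shared by \<open>q\<close>, and its multiplicity does not matter because
  \<open>(T - a)\<^sup>2 w = 0\<close> implies \<open>(T - a) w = 0\<close>.\<close>

lemma op_poly_vanishes:
  assumes T: "pos_semidef T"
    and "p \<noteq> 0" "op_poly T p x = 0" "\<forall>l\<ge>0. poly p l = 0 \<longrightarrow> poly q l = 0"
  shows "op_poly T q x = 0"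
  using assms(2-)
proof (induction "degree p" arbitrary: p x rule: less_induct)
  case less
  have op: "operator T" and sa: "selfadjoint T" and pos: "\<And>x. \<exists>r\<ge>0. ip (T x) x = of_real r"
    using T by (auto simp: pos_semidef_iff)
  have reduce: "op_poly T q y = 0"
    if "p = u * s" "degree u > 0" "op_poly T s y = 0" for u s y
  proof (rule less(1)[of s])
    show "degree s < degree p" "s \<noteq> 0"
      using that less(2) by (auto simp: degree_mult_eq)
    show "\<forall>l\<ge>0. poly s l = 0 \<longrightarrow> poly q l = 0"
      using less(4) that(1) by simp
  qed fact
  have lin: "op_poly T [:- a, 1:] v = T v - of_real a *s v" for a v
    by (simp add: op_poly_pCons op operator_zero)
  show ?case
  proof (cases "degree p = 0")
    case True
    then obtain a where "p = [:a:]"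
      using degree_eq_zeroE by blast
    then have "x = 0"
      using less(2,3) by (simp add: op_poly_pCons op operator_zero)
    then show ?thesis
      by (simp add: operator_zero op_poly_operator op)
  next
    case False
    then have "degree p > 0" by simp
    then show ?thesis
    proof (cases rule: real_poly_factor)
      case (linear a)
      then obtain s where s: "p = [:- a, 1:] * s" by (elim dvdE)
      show ?thesis
      proof (cases "a \<ge> 0")
        case True
        then have "[:- a, 1:] dvd q"
          using less(4) s by (simp add: poly_eq_0_iff_dvd[symmetric])
        then obtain q' where q': "q = [:- a, 1:] * q'" by (elim dvdE)
        have "op_poly T s (op_poly T [:- a, 1:] x) = 0"
          using less(3) by (simp only: s op_poly_mult[OF op, symmetric] mult.commute)
        then have "op_poly T q (op_poly T [:- a, 1:] x) = 0"
          using reduce[OF s] by simp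
        then have "op_poly T [:- a, 1:] (op_poly T [:- a, 1:] (op_poly T q' x)) = 0"
          by (simp only: q' op_poly_mult[OF op, symmetric] mult.assoc mult.commute
              mult.left_commute)
        then show ?thesis
          using selfadjoint_kernel_square[OF op_poly_selfadjoint[OF op sa] op_poly_operator[OF op]]
          by (simp only: q' op_poly_mult[OF op])
      next
        case False
        define y where "y = op_poly T s x"
        have "op_poly T [:- a, 1:] y = 0"
          using less(3) by (simp only: s op_poly_mult[OF op] y_def)
        then have "T y = of_real a *s y"
          by (simp add: lin)
        then have "ip (T y) y = of_real (a * (hnorm y)\<^sup>2)"
          by (simp add: ip_scale_left ip_self)
        then have "a * (hnorm y)\<^sup>2 \<ge> 0"
          using pos[of y] by (metis of_real_eq_iff)
        then have "y = 0"
          using False by (simp add: zero_le_mult_iff hnorm_eq_0_iff)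
        then show ?thesis
          using reduce[OF s] by (simp add: y_def)
      qed
    next
      case (quadratic a b)
      then obtain s where s: "p = [:a\<^sup>2 + b\<^sup>2, - 2 * a, 1:] * s" by (elim dvdE)
      define y where "y = op_poly T s x"
      define D where "D = op_poly T [:- a, 1:]"
      have square: "[:a\<^sup>2 + b\<^sup>2, - 2 * a, 1:] = [:- a, 1:] * [:- a, 1:] + [:b\<^sup>2:]"
        by (simp add: power2_eq_square)
      have "0 = op_poly T [:a\<^sup>2 + b\<^sup>2, - 2 * a, 1:] y"
        using less(3) by (simp only: s op_poly_mult[OF op] y_def)
      also have "\<dots> = D (D y) + of_real (b\<^sup>2) *s y"
        unfolding square op_poly_add[OF op] op_poly_mult[OF op] D_def
        by (simp add: op_poly_pCons[OF op] operator_zero[OF op])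
      finally have "ip (D (D y) + of_real (b\<^sup>2) *s y) y = 0"
        by (metis ip_zero_left)
      moreover have "ip (D (D y)) y = ip (D y) (D y)"
        using op_poly_selfadjoint[OF op sa] by (simp add: D_def selfadjoint_def)
      ultimately have "(of_real ((hnorm (D y))\<^sup>2 + b\<^sup>2 * (hnorm y)\<^sup>2) :: 'k) = 0"
        by (simp add: ip_add_left ip_scale_left ip_self)
      then have "(hnorm (D y))\<^sup>2 + b\<^sup>2 * (hnorm y)\<^sup>2 = 0"
        by (simp only: of_real_eq_0_iff)
      then have "y = 0"
        using quadratic(1) by (simp add: add_nonneg_eq_0_iff hnorm_eq_0_iff)
      then show ?thesis
        using reduce[OF s] by (simp add: y_def)
    qed
  qed
qed

text \<open>The set \<open>L\<close> contains the spectrum of \<open>T\<close>, so a real polynomial in \<open>T\<close> depends only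
  on the values of the polynomial on \<open>L\<close>.\<close>

lemma spectrum:
  assumes "pos_semidef T"
  obtains L where "finite L" "\<forall>l\<in>L. l \<ge> 0"
    "\<And>p q x. \<forall>l\<in>L. poly p l = poly q l \<Longrightarrow> op_poly T p x = op_poly T q x"
proof -
  have op: "operator T" "selfadjoint T"
    using assms by (auto simp: pos_semidef_iff)
  obtain m where m: "m \<noteq> 0" "\<And>x. op_poly T m x = 0"
    using real_annihilator[OF op] by blast
  have "op_poly T p x = op_poly T q x" if "\<forall>l\<in>{l. poly m l = 0 \<and> l \<ge> 0}. poly p l = poly q l"
    for p q x
    using op_poly_vanishes[OF assms m, of "p - q" x] that by (simp add: op_poly_diff op)
  moreover have "finite {l. poly m l = 0 \<and> l \<ge> 0}"
    using poly_roots_finite[OF m(1)] by (rule finite_subset[rotated]) auto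
  ultimately show thesis
    using that[of "{l. poly m l = 0 \<and> l \<ge> 0}"] by blast
qed

text \<open>Positivity comes from \<open>q(T) = r(T)\<^sup>2\<close>, where \<open>r\<close> interpolates the square root of
  \<open>q\<close> on the spectrum.\<close>

lemma pos_semidef_op_poly:
  assumes T: "pos_semidef T"
    and L: "finite L" "\<And>p q x. \<forall>l\<in>L. poly p l = poly q l \<Longrightarrow> op_poly T p x = op_poly T q x"
    and q: "\<forall>l\<in>L. poly q l \<ge> 0"
  shows "pos_semidef (op_poly T q)"
proof -
  have op: "operator T" "selfadjoint T"
    using T by (auto simp: pos_semidef_iff)
  obtain r where r: "\<forall>l\<in>L. poly r l = sqrt (poly q l)"
    using real_poly_interpolation[OF L(1), of "\<lambda>l. sqrt (poly q l)"] by blast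
  have "op_poly T q x = op_poly T r (op_poly T r x)" for x
    using L(2)[of q "r * r" x] r q by (simp add: op_poly_mult op)
  then have "ip (op_poly T q x) x = of_real ((hnorm (op_poly T r x))\<^sup>2)" for x
    using selfadjointD[OF op_poly_selfadjoint[OF op, of r]] by (metis ip_self)
  then have "\<forall>x. \<exists>s\<ge>0. ip (op_poly T q x) x = of_real s"
    by (metis zero_le_power2)
  then show ?thesis
    by (simp add: pos_semidef_iff op_poly_operator op_poly_selfadjoint op)
qed

text \<open>For \<open>T = R\<^sup>2\<close> with \<open>R\<close> self-adjoint the form is \<open>\<parallel>R x\<parallel>\<^sup>2\<close>.\<close>

lemma pos_semidef_form_0:
  assumes T: "pos_semidef T" and "ip (T x) x = 0"
  shows "T x = 0"
proof -
  have op: "operator T" "selfadjoint T"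
    using T by (auto simp: pos_semidef_iff)
  obtain L where L: "finite L" "\<forall>l\<in>L. l \<ge> 0"
      "\<And>p q x. \<forall>l\<in>L. poly p l = poly q l \<Longrightarrow> op_poly T p x = op_poly T q x"
    using spectrum[OF T] by blast
  obtain r where r: "\<forall>l\<in>L. poly r l = sqrt l"
    using real_poly_interpolation[OF L(1)] by blast
  have T_eq: "T x = op_poly T r (op_poly T r x)" for x
    using L(3)[of "[:0, 1:]" "r * r" x] r L(2) by (simp add: op_poly_mult op op_poly_X)
  then have "ip (op_poly T r x) (op_poly T r x) = 0"
    using assms(2) selfadjointD[OF op_poly_selfadjoint[OF op, of r]] by metis
  then show ?thesis
    by (simp add: T_eq ip_self_eq_0_iff operator_zero op_poly_operator op)
qed

section \<open>Square roots and pseudoinverses\<close>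

text \<open>Any positive square root \<open>S\<close> of \<open>T\<close> commutes with \<open>T\<close>, hence with the square root
  \<open>R = r(T)\<close>. On a vector \<open>y = (S - R) x\<close> the forms of \<open>S\<close> and \<open>R\<close> have
  sum \<open>\<langle>(S\<^sup>2 - R\<^sup>2) x, y\<rangle> = 0\<close>, so both vanish and \<open>(S - R)\<^sup>2 x = 0\<close>.\<close>

lemma pos_sqrt_spec:
  assumes T: "pos_semidef T"
  shows "pos_semidef (pos_sqrt T)" "pos_sqrt T (pos_sqrt T x) = T x"
proof -
  have op: "operator T" "selfadjoint T"
    using T by (auto simp: pos_semidef_iff)
  obtain L where L: "finite L" "\<forall>l\<in>L. l \<ge> 0"
      "\<And>p q x. \<forall>l\<in>L. poly p l = poly q l \<Longrightarrow> op_poly T p x = op_poly T q x"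
    using spectrum[OF T] by blast
  obtain r where r: "\<forall>l\<in>L. poly r l = sqrt l"
    using real_poly_interpolation[OF L(1)] by blast
  define R where "R = op_poly T r"
  have RR: "R (R x) = T x" for x
    using L(3)[of "r * r" "[:0, 1:]" x] r L(2) by (simp add: op_poly_mult op op_poly_X R_def)
  have R: "pos_semidef R"
    unfolding R_def using r L(2) by (intro pos_semidef_op_poly[OF T L(1,3)]) auto
  have unique: "S = R" if S: "pos_semidef S" and "S \<circ> S = T" for S
  proof
    fix x
    have SS: "S (S z) = T z" for z
      using that(2) by (metis comp_apply)
    have opS: "operator S" "selfadjoint S" and opR: "operator R" "selfadjoint R"
      using S R by (auto simp: pos_semidef_iff)
    have comm: "S (R z) = R (S z)" for z
      unfolding R_def by (rule op_poly_commute[OF op(1) opS(1)]) (simp flip: SS)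
    define y where "y = S x - R x"
    have "S y + R y = 0"
      by (simp add: y_def operator_diff opS opR SS RR comm)
    then have "ip (S y) y + ip (R y) y = 0"
      by (metis ip_add_left ip_zero_left)
    moreover obtain s t where st: "s \<ge> 0" "ip (S y) y = of_real s" "t \<ge> 0" "ip (R y) y = of_real t"
      using S R unfolding pos_semidef_iff by metis
    ultimately have "(of_real (s + t) :: 'k) = 0" by simp
    then have "s + t = 0"
      by (simp only: of_real_eq_0_iff)
    then have "S y = 0" "R y = 0"
      using st pos_semidef_form_0 S R by (auto simp: add_nonneg_eq_0_iff)
    then have "ip y y = 0"
      using selfadjointD[OF opS(2), of x y] selfadjointD[OF opR(2), of x y]
      by (subst y_def) (simp add: ip_diff_left)
    then show "S x = R x"
      by (simp add: ip_self_eq_0_iff y_def)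
  qed
  have "pos_sqrt T = R"
    unfolding pos_sqrt_def
  proof (rule the_equality)
    show "pos_semidef R \<and> R \<circ> R = T"
      using R RR by (simp add: fun_eq_iff)
  qed (use unique in blast)
  then show "pos_semidef (pos_sqrt T)" "pos_sqrt T (pos_sqrt T x) = T x"
    using R RR by simp_all
qed

text \<open>Penrose's argument: taking adjoints in \<open>T X = (T Y) (T X)\<close>, where all factors are
  self-adjoint, gives \<open>T X = (T X) (T Y) = T Y\<close>. Similarly \<open>X T = Y T\<close>, and then
  \<open>X = X T X = Y T Y = Y\<close>.\<close>

lemma pinv_unique:
  assumes "operator T"
    and X: "operator X" "\<And>x. T (X (T x)) = T x" "\<And>x. X (T (X x)) = X x"
      "selfadjoint (T \<circ> X)" "selfadjoint (X \<circ> T)"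
    and Y: "operator Y" "\<And>x. T (Y (T x)) = T x" "\<And>x. Y (T (Y x)) = Y x"
      "selfadjoint (T \<circ> Y)" "selfadjoint (Y \<circ> T)"
  shows "X = Y"
proof
  fix x
  have TX: "ip (T (X u)) v = ip u (T (X v))" and XT: "ip (X (T u)) v = ip u (X (T v))"
    and TY: "ip (T (Y u)) v = ip u (T (Y v))" and YT: "ip (Y (T u)) v = ip u (Y (T v))" for u v
    using X Y by (auto simp: selfadjoint_def)
  have TX_TY: "T (X u) = T (Y u)" for u
  proof (rule ip_left_unique)
    fix v
    have "ip (T (X u)) v = ip (T (Y (T (X u)))) v" by (simp add: Y)
    also have "\<dots> = ip u (T (X (T (Y v))))" by (simp add: TX TY)
    also have "\<dots> = ip (T (Y u)) v" by (simp add: X TY)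
    finally show "ip (T (X u)) v = ip (T (Y u)) v" .
  qed
  have XT_YT: "X (T u) = Y (T u)" for u
  proof (rule ip_left_unique)
    fix v
    have "ip (X (T u)) v = ip (X (T (Y (T u)))) v" by (simp add: Y)
    also have "\<dots> = ip u (Y (T (X (T v))))" by (simp add: XT YT)
    also have "\<dots> = ip (Y (T u)) v" by (simp add: X YT)
    finally show "ip (X (T u)) v = ip (Y (T u)) v" .
  qed
  have "X x = X (T (X x))" by (simp add: X)
  also have "\<dots> = Y (T (Y x))" by (simp add: TX_TY XT_YT)
  also have "\<dots> = Y x" by (simp add: Y)
  finally show "X x = Y x" .
qed

text \<open>The pseudoinverse is \<open>q(T)\<close> with \<open>q(\<lambda>) = 1 / \<lambda>\<close> on the spectrum. At \<open>\<lambda> = 0\<close> the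
  convention \<open>inverse 0 = 0\<close> gives the value that the Penrose equations require.\<close>

lemma pinv_spec:
  assumes T: "pos_semidef T"
  shows "pos_semidef (pinv T)" "pinv T (T x) = T (pinv T x)" "T (T (pinv T x)) = T x"
proof -
  have op: "operator T" "selfadjoint T"
    using T by (auto simp: pos_semidef_iff)
  obtain L where L: "finite L" "\<forall>l\<in>L. l \<ge> 0"
      "\<And>p q x. \<forall>l\<in>L. poly p l = poly q l \<Longrightarrow> op_poly T p x = op_poly T q x"
    using spectrum[OF T] by blast
  obtain q where q: "\<forall>l\<in>L. poly q l = inverse l"
    using real_poly_interpolation[OF L(1)] by blast
  define X where "X = op_poly T q"
  have X: "pos_semidef X"
    unfolding X_def using q L(2) by (intro pos_semidef_op_poly[OF T L(1,3)]) auto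
  then have opX: "operator X" "selfadjoint X"
    by (auto simp: pos_semidef_iff)
  have comm: "T (X x) = X (T x)" for x
    unfolding X_def by (rule op_poly_commute) (simp_all add: op)
  have "op_poly T ([:0, 1:] * (q * [:0, 1:])) x = op_poly T [:0, 1:] x" for x
    by (rule L(3)) (use q in \<open>auto intro: right_inverse\<close>)
  then have TXT: "T (X (T x)) = T x" for x
    by (simp only: op_poly_mult[OF op(1)] op_poly_X[OF op(1)] X_def)
  have "op_poly T (q * ([:0, 1:] * q)) x = op_poly T q x" for x
    by (rule L(3)) (use q in \<open>auto intro: right_inverse\<close>)
  then have XTX: "X (T (X x)) = X x" for x
    by (simp only: op_poly_mult[OF op(1)] op_poly_X[OF op(1)] X_def)
  have sa: "selfadjoint (T \<circ> X)" "selfadjoint (X \<circ> T)"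
    using op(2) opX(2) by (auto simp: selfadjoint_def comm)
  have comp: "operator (S \<circ> S')" if "operator S" "operator S'" for S S'
    using that by (intro operatorI) (simp_all add: operator_add operator_scale)
  have "pinv T = X"
    unfolding pinv_def
  proof (rule the_equality)
    show "operator X \<and> T \<circ> X \<circ> T = T \<and> X \<circ> T \<circ> X = X \<and>
        adj (T \<circ> X) = T \<circ> X \<and> adj (X \<circ> T) = X \<circ> T"
      using sa by (auto simp: opX op TXT XTX comp adj_eq_self_iff)
  next
    fix Y
    assume Y: "operator Y \<and> T \<circ> Y \<circ> T = T \<and> Y \<circ> T \<circ> Y = Y \<and>
        adj (T \<circ> Y) = T \<circ> Y \<and> adj (Y \<circ> T) = Y \<circ> T"
    have "selfadjoint (T \<circ> Y)" "selfadjoint (Y \<circ> T)"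
      using Y op comp adj_eq_self_iff by blast+
    moreover have "T (Y (T x)) = T x" "Y (T (Y x)) = Y x" for x
      using Y by (metis comp_apply)+
    ultimately show "Y = X"
      using Y sa TXT XTX opX by (intro pinv_unique[OF op(1)]) auto
  qed
  then show "pos_semidef (pinv T)" "pinv T (T x) = T (pinv T x)" "T (T (pinv T x)) = T x"
    using X comm TXT by simp_all
qed

section \<open>Parseval frames and their duals\<close>

text \<open>Both sides are self-adjoint in \<open>x\<close>, and the Parseval identity says that their quadratic
  forms agree.\<close>

lemma parseval_frame_operator:
  assumes K: "pos_semidef K" and F: "parseval_frame K N f"
  shows "(\<Sum>i=1..N. ip x (f i) *s f i) = K (K x)"
proof -
  have op: "operator K" "selfadjoint K"
    using K by (auto simp: pos_semidef_iff)
  have "adj K = K"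
    using K by (simp add: pos_semidef_def)
  define D where "D x = (\<Sum>i=1..N. ip x (f i) *s f i) - K (K x)" for x
  have "operator D"
    unfolding D_def
    by (intro operatorI)
      (simp_all add: operator_add operator_scale op ip_add_left ip_scale_left scale_left_distrib
        sum.distrib scale_sum_right scale_right_diff_distrib)
  moreover have "ip (D x) y = ip x (D y)" for x y
  proof -
    have "ip (\<Sum>i=1..N. ip x (f i) *s f i) y = ip x (\<Sum>i=1..N. ip y (f i) *s f i)"
      unfolding ip_sum_left ip_sum_right ip_scale_left ip_scale_right
      by (intro sum.cong refl) (metis ip_commute mult.commute)
    moreover have "ip (K (K x)) y = ip x (K (K y))"
      by (simp add: selfadjointD[OF op(2)])
    ultimately show ?thesis
      by (simp add: D_def ip_diff_left ip_diff_right)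
  qed
  then have "selfadjoint D" by (simp add: selfadjoint_def)
  moreover have "ip (D x) x = 0" for x
  proof -
    have "ip (\<Sum>i=1..N. ip x (f i) *s f i) x = of_real (\<Sum>i=1..N. (norm (ip x (f i)))\<^sup>2)"
      unfolding ip_sum_left ip_scale_left of_real_sum
      by (intro sum.cong refl) (metis ip_commute conjugate_mult_self mult.commute)
    also have "\<dots> = of_real ((hnorm (K x))\<^sup>2)"
      using F \<open>adj K = K\<close> by (simp add: parseval_frame_def)
    also have "\<dots> = ip (K (K x)) x"
      by (simp add: selfadjointD[OF op(2)] ip_self)
    finally show ?thesis by (simp add: D_def ip_diff_left)
  qed
  ultimately have "D x = 0"
    by (rule selfadjoint_eq_0_if_form_0)
  then show ?thesis by (simp add: D_def)
qed

text \<open>The operator \<open>K K\<^sup>\<dagger>\<close> is the projection onto the range of \<open>K\<close>. The frame vectors lie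
  in that range, since the Parseval identity makes them orthogonal to the kernel of \<open>K\<close>.\<close>

lemma parseval_frame_in_range:
  assumes K: "pos_semidef K" and F: "parseval_frame K N f" and i: "i \<in> {1..N}"
  shows "K (pinv K (f i)) = f i"
proof -
  have op: "operator K" "selfadjoint K"
    using K by (auto simp: pos_semidef_iff)
  have "adj K = K"
    using K by (simp add: pos_semidef_def)
  define e where "e = f i - K (pinv K (f i))"
  have Ke: "K e = 0"
    by (simp add: e_def operator_diff op pinv_spec[OF K])
  have "(\<Sum>j=1..N. (norm (ip e (f j)))\<^sup>2) = 0"
    using F \<open>adj K = K\<close> Ke by (simp add: parseval_frame_def hnorm_eq_0_iff)
  then have "ip e (f i) = 0"
    using i by (simp add: sum_nonneg_eq_0_iff)
  moreover have "ip e (K (pinv K (f i))) = 0"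
    using selfadjointD[OF op(2), of e] Ke by simp
  ultimately have "ip e e = 0"
    by (subst (2) e_def) (simp add: ip_diff_right)
  then show ?thesis
    by (simp add: ip_self_eq_0_iff e_def)
qed

lemma canonical_dual_K_dual:
  assumes K: "pos_semidef K" and F: "parseval_frame K N f"
  shows "K_dual K N f (canonical_dual K f)"
proof -
  have "selfadjoint (pinv K)"
    using pinv_spec(1)[OF K] by (simp add: pos_semidef_iff)
  then have "(\<Sum>i=1..N. ip x (pinv K (f i)) *s f i) = (\<Sum>i=1..N. ip (pinv K x) (f i) *s f i)" for x
    by (simp add: selfadjoint_def)
  then have "(\<Sum>i=1..N. ip x (pinv K (f i)) *s f i) = K x" for x
    unfolding parseval_frame_operator[OF K F] by (simp add: pinv_spec[OF K])
  then show ?thesis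
    by (simp add: K_dual_def canonical_dual_def)
qed

lemma ip_canonical_dual:
  assumes K: "pos_semidef K"
  shows "ip x (pinv K x) = of_real ((hnorm (pos_sqrt (pinv K) x))\<^sup>2)"
proof -
  have R: "selfadjoint (pos_sqrt (pinv K))"
    using pos_sqrt_spec(1)[OF pinv_spec(1)[OF K]] by (simp add: pos_semidef_iff)
  show ?thesis
    using selfadjointD[OF R, of x "pos_sqrt (pinv K) x"] pos_sqrt_spec(2)[OF pinv_spec(1)[OF K]]
    by (simp only: ip_self)
qed

text \<open>The sum in the conclusion is the trace of the zero operator \<open>x \<mapsto> \<Sum>\<^sub>i \<langle>x, h\<^sub>i\<rangle> f\<^sub>i\<close>.
  No orthonormal basis is needed to see this: the vectors \<open>K\<^sup>\<dagger> f\<^sub>j\<close> form a Parseval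
  frame of the range of \<open>K\<close>, which contains every \<open>f\<^sub>i\<close>, and expanding \<open>f\<^sub>i\<close> in them
  and exchanging the sums gives the result.\<close>

lemma trace_zero:
  assumes K: "pos_semidef K" and F: "parseval_frame K N f" and J: "J \<subseteq> {1..N}"
    and zero: "\<And>x. (\<Sum>i\<in>J. ip x (h i) *s f i) = 0"
  shows "(\<Sum>i\<in>J. ip (f i) (h i)) = 0"
proof -
  have opX: "operator (pinv K)"
    using pinv_spec(1)[OF K] by (simp add: pos_semidef_iff)
  define u where "u j = pinv K (f j)" for j
  have expand: "f i = (\<Sum>j=1..N. ip (f i) (u j) *s u j)" if "i \<in> {1..N}" for i
  proof -
    have "(\<Sum>j=1..N. ip (f i) (u j) *s u j) = pinv K (\<Sum>j=1..N. ip (f i) (u j) *s f j)"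
      by (simp add: operator_sum operator_scale opX u_def)
    also have "(\<Sum>j=1..N. ip (f i) (u j) *s f j) = K (f i)"
      using canonical_dual_K_dual[OF K F] by (simp add: K_dual_def canonical_dual_def u_def)
    also have "pinv K (K (f i)) = f i"
      using parseval_frame_in_range[OF K F that] pinv_spec(2)[OF K] by simp
    finally show ?thesis by simp
  qed
  have "(\<Sum>i\<in>J. ip (f i) (h i)) = (\<Sum>i\<in>J. \<Sum>j=1..N. ip (u j) (h i) * ip (f i) (u j))"
  proof (rule sum.cong[OF refl])
    fix i assume "i \<in> J"
    then have "f i = (\<Sum>j=1..N. ip (f i) (u j) *s u j)"
      using J expand by blast
    then have "ip (f i) (h i) = ip (\<Sum>j=1..N. ip (f i) (u j) *s u j) (h i)"
      by simp
    then show "ip (f i) (h i) = (\<Sum>j=1..N. ip (u j) (h i) * ip (f i) (u j))"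
      by (simp add: ip_sum_left ip_scale_left mult.commute)
  qed
  also have "\<dots> = (\<Sum>j=1..N. ip (\<Sum>i\<in>J. ip (u j) (h i) *s f i) (u j))"
    by (subst sum.swap) (simp add: ip_sum_left ip_scale_left)
  also have "\<dots> = 0"
    by (simp add: zero)
  finally show ?thesis .
qed

text \<open>On \<open>J\<close> the numbers \<open>\<langle>f\<^sub>i, g\<^sub>i\<rangle>\<close> have the same sum for every dual \<open>g\<close>, as two
  duals differ by some \<open>h\<close> with \<open>\<Sum>\<^sub>i \<langle>x, h\<^sub>i\<rangle> f\<^sub>i = 0\<close> and, as the spans are independent,
  the part of this sum over \<open>J\<close> is zero by itself. For the canonical dual all terms
  on \<open>J\<close> equal \<open>M\<close>, so for any dual one of them has modulus at least \<open>M\<close>.\<close>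

lemma r1_ge_if_constant_on_block:
  assumes K: "pos_semidef K" and F: "parseval_frame K N f"
    and J: "J \<subseteq> {1..N}" "J \<noteq> {}"
    and const: "\<And>i. i \<in> J \<Longrightarrow> ip (f i) (pinv K (f i)) = of_real M"
    and disj: "span (f ` J) \<inter> span (f ` ({1..N} - J)) = {0}"
    and dual: "K_dual K N f g"
  shows "M \<le> r1 N f g"
proof -
  define h where "h i = g i - pinv K (f i)" for i
  have fin: "finite J"
    using J(1) finite_subset by blast
  have "(\<Sum>i\<in>J. ip x (h i) *s f i) = 0" for x
  proof -
    have "(\<Sum>i=1..N. ip x (h i) *s f i) = K x - K x"
      using dual canonical_dual_K_dual[OF K F]
      by (simp add: h_def ip_diff_right scale_left_diff_distrib sum_subtractf K_dual_def
          canonical_dual_def)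
    moreover have "(\<Sum>i=1..N. ip x (h i) *s f i) =
        (\<Sum>i\<in>{1..N} - J. ip x (h i) *s f i) + (\<Sum>i\<in>J. ip x (h i) *s f i)"
      using J(1) by (intro sum.subset_diff) auto
    ultimately have "(\<Sum>i\<in>J. ip x (h i) *s f i) = - (\<Sum>i\<in>{1..N} - J. ip x (h i) *s f i)"
      by (simp add: eq_neg_iff_add_eq_0 add.commute)
    moreover have "(\<Sum>i\<in>J. ip x (h i) *s f i) \<in> span (f ` J)"
      by (intro span_sum span_scale span_base) auto
    moreover have "- (\<Sum>i\<in>{1..N} - J. ip x (h i) *s f i) \<in> span (f ` ({1..N} - J))"
      by (intro span_neg span_sum span_scale span_base) auto
    ultimately have "(\<Sum>i\<in>J. ip x (h i) *s f i) \<in> span (f ` J) \<inter> span (f ` ({1..N} - J))"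
      by (metis IntI)
    then show ?thesis
      unfolding disj by (rule singletonD)
  qed
  then have "(\<Sum>i\<in>J. ip (f i) (h i)) = 0"
    by (rule trace_zero[OF K F J(1)])
  then have "(\<Sum>i\<in>J. ip (f i) (g i)) = (\<Sum>i\<in>J. ip (f i) (pinv K (f i)))"
    by (simp add: h_def ip_diff_right sum_subtractf)
  also have "\<dots> = of_real (card J * M)"
    using const by simp
  finally have "norm (\<Sum>i\<in>J. ip (f i) (g i)) = \<bar>card J * M\<bar>"
    by (simp only: norm_of_real)
  then have "card J * M \<le> (\<Sum>i\<in>J. norm (ip (f i) (g i)))"
    using norm_sum[of "\<lambda>i. ip (f i) (g i)" J] by linarith
  also have "\<dots> \<le> card J * r1 N f g"
    using J(1) by (intro sum_bounded_above) (auto simp: r1_def intro!: Max_ge)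
  finally show ?thesis
    using J(2) fin by (simp add: card_gt_0_iff)
qed

lemma spectrally_optimal_if_minimal:
  assumes "K_dual K N f g" "\<And>g'. K_dual K N f g' \<Longrightarrow> r1 N f g \<le> r1 N f g'"
  shows "spectrally_optimal K N f g"
proof -
  have "Inf {r1 N f g' | g'. K_dual K N f g'} = r1 N f g"
    using assms by (intro cInf_eq_minimum) auto
  then show ?thesis
    using assms(1) by (simp add: spectrally_optimal_def r1_inf_def)
qed

end

section \<open>Optimality of the canonical dual\<close>

theorem theorem4p14:
  fixes scale :: "'k::real_or_complex_field \<Rightarrow> 'v::ab_group_add \<Rightarrow> 'v"
    and ip :: "'v \<Rightarrow> 'v \<Rightarrow> 'k"
    and n N :: nat
    and K :: "'v \<Rightarrow> 'v"
    and f :: "nat \<Rightarrow> 'v"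
    and M :: real
    and J1 J2 :: "nat set"
    and W1 W2 :: "'v set"
  assumes "hilbert_space scale ip n"
    and "N \<ge> 1"
    and "hilbert_space.pos_semidef scale ip K"
    and "hilbert_space.parseval_frame ip K N f"
    and "M = Max ((\<lambda>i. (hilbert_space.hnorm ip
      (hilbert_space.pos_sqrt scale ip (hilbert_space.pinv scale ip K) (f i)))\<^sup>2) ` {1..N})"
    and "J1 = {i \<in> {1..N}. (hilbert_space.hnorm ip
      (hilbert_space.pos_sqrt scale ip (hilbert_space.pinv scale ip K) (f i)))\<^sup>2 = M}"
    and "J2 = {1..N} - J1"
    and "W1 = module.span scale (f ` J1)"
    and "W2 = module.span scale (f ` J2)"
    and "W1 \<inter> W2 = {0}"
  shows "hilbert_space.spectrally_optimal scale ip K N f (hilbert_space.canonical_dual scale ip K f)"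
proof -
  interpret hilbert_space scale ip n by fact
  have K: "pos_semidef K" and F: "parseval_frame K N f"
    using assms(3,4) by simp_all
  define m where "m i = (hnorm (pos_sqrt (pinv K) (f i)))\<^sup>2" for i
  have M: "M = Max (m ` {1..N})" and J1: "J1 = {i \<in> {1..N}. m i = M}"
    using assms(5,6) by (simp_all add: m_def)
  have diag: "ip (f i) (pinv K (f i)) = of_real (m i)" for i
    by (simp add: m_def ip_canonical_dual[OF K])
  have "m i \<ge> 0" for i
    by (simp add: m_def)
  then have r1_canonical: "r1 N f (canonical_dual K f) = M"
    by (simp add: r1_def canonical_dual_def diag M)
  have "M \<in> m ` {1..N}"
    unfolding M using assms(2) by (intro Max_in) auto
  then have "J1 \<noteq> {}"
    by (auto simp: J1)
  show ?thesis
  proof (rule spectrally_optimal_if_minimal[OF canonical_dual_K_dual[OF K F]])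
    fix g assume "K_dual K N f g"
    then have "M \<le> r1 N f g"
      using assms(7-10) \<open>J1 \<noteq> {}\<close>
      by (intro r1_ge_if_constant_on_block[OF K F, of J1]) (auto simp: J1 diag)
    then show "r1 N f (canonical_dual K f) \<le> r1 N f g"
      by (simp add: r1_canonical)
  qed
qed

end
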